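(* Let $K\subseteq R$ and $K'\subseteq R'$ be (not necessarily commutative) subfields of rings $R,R'$, let $\alpha:R\to R'$ be a Jordan homomorphism, let $R''$ be the subring of $R'$ generated by $R^\alpha$, and let $\overline\alpha:C\to C''$ be the (well defined) mapping $R(1,0)\cdot E(T)\mapsto R'(1',0')\cdot E(T^\alpha)$ for finite sequences $T$ in $R$. Then $\overline\alpha$ maps every $K$-chain contained in $C$ into a $K'$-chain if and only if for each $c\in R^*$ there is a $u'_c\in R'^*$ such that $(Kc)^\alpha\subseteq ({u'_c}^{-1}K'u'_c)\,c^\alpha$.
   Context: Rings are associative with $1$, subfields contain $1$. A Jordan homomorphism $\alpha:R\to R'$ satisfies $(a+b)^\alpha=a^\alpha+b^\alpha$, $1^\alpha=1'$, $(aba)^\alpha=a^\alpha b^\alpha a^\alpha$. For $t$ in a ring, $E(t):=\begin{pmatrix} t&1\\-1&0\end{pmatrix}$; $E(T):=E(t_1)\cdots E(t_n)$ for $T=(t_1,\ldots,t_n)$ ($=I$ if $n=0$), $T^\alpha:=(t_1^\alpha,\ldots,t_n^\alpha)$. The projective line $\mathbb{P}(R)$ is the set of submodules $R(a,b)\leq R^2$ with $(a,b)$ the first row of a matrix in $GL_2(R)$, with right action $R(a,b)\cdot M=R((a,b)M)$. Points are distant if representatives form a basis of $R^2$. $C$ is the connected component of $R(1,0)$ in the distant graph of $\mathbb{P}(R)$; $\mathbb{P}(R'')$ is identified with a subset of $\mathbb{P}(R')$ via $R''(a,b)\mapsto R'(a,b)$ and $C''$ is the connected component of $R''(1',0')$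 in $\mathbb{P}(R'')$. The projective line $\mathbb{P}(K)$ is identified with the subset $\{R(a,b)\mid (a,b)\in K^2\setminus\{(0,0)\}\}$ of $\mathbb{P}(R)$; the $K$-chains are the images of this set under $GL_2(R)$ (chain geometry $\Sigma(K,R)$). $K'$-chains in $\mathbb{P}(R')$ are defined analogously. *)

theory Defs
  imports Main
begin

text \<open>Rings are modelled by type classes: R = UNIV :: 'a, R' = UNIV :: 'b, with
  'a, 'b :: ring_1 (associative, with 1, not necessarily commutative).\<close>

definition subfield :: "'a::ring_1 set \<Rightarrow> bool" where
  "subfield K \<longleftrightarrow> 0 \<in> K \<and> 1 \<in> K \<and>
     (\<forall>x\<in>K. \<forall>y\<in>K. x + y \<in> K \<and> x * y \<in> K \<and> - x \<in> K) \<and>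
     (\<forall>x\<in>K. x \<noteq> 0 \<longrightarrow> (\<exists>y\<in>K. x * y = 1 \<and> y * x = 1))"

definition ring_unit :: "'a::ring_1 \<Rightarrow> bool" where
  "ring_unit u \<longleftrightarrow> (\<exists>v. u * v = 1 \<and> v * u = 1)"

definition jordan_hom :: "('a::ring_1 \<Rightarrow> 'b::ring_1) \<Rightarrow> bool" where
  "jordan_hom f \<longleftrightarrow> (\<forall>a b. f (a + b) = f a + f b) \<and> f 1 = 1 \<and>
     (\<forall>a b. f (a * b * a) = f a * f b * f a)"

text \<open>2x2 matrices, given by their rows ((a,b),(c,d)).\<close>
type_synonym 'a mat2 = "('a \<times> 'a) \<times> ('a \<times> 'a)"

definition vmul :: "'a::ring_1 \<times> 'a \<Rightarrow> 'a mat2 \<Rightarrow> 'a \<times> 'a" where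
  "vmul v M = (fst v * fst (fst M) + snd v * fst (snd M),
               fst v * snd (fst M) + snd v * snd (snd M))"

definition mmul :: "'a::ring_1 mat2 \<Rightarrow> 'a mat2 \<Rightarrow> 'a mat2" where
  "mmul M N = (vmul (fst M) N, vmul (snd M) N)"

definition mid :: "'a::ring_1 mat2" where
  "mid = ((1, 0), (0, 1))"

definition GL2 :: "'a::ring_1 mat2 set" where
  "GL2 = {M. \<exists>N. mmul M N = mid \<and> mmul N M = mid}"

definition Emat :: "'a::ring_1 \<Rightarrow> 'a mat2" where
  "Emat t = ((t, 1), (- 1, 0))"

definition Eseq :: "'a::ring_1 list \<Rightarrow> 'a mat2" where
  "Eseq T = foldr (\<lambda>t M. mmul (Emat t) M) T mid"

definition pt :: "'a::ring_1 \<times> 'a \<Rightarrow> ('a \<times> 'a) set" where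
  "pt v = {(r * fst v, r * snd v) | r. True}"

definition projline :: "('a::ring_1 \<times> 'a) set set" where
  "projline = {pt (fst M) | M. M \<in> GL2}"

definition act :: "('a::ring_1 \<times> 'a) set \<Rightarrow> 'a mat2 \<Rightarrow> ('a \<times> 'a) set" where
  "act p M = (\<lambda>v. vmul v M) ` p"

definition is_basis :: "'a::ring_1 \<times> 'a \<Rightarrow> 'a \<times> 'a \<Rightarrow> bool" where
  "is_basis v w \<longleftrightarrow> (\<forall>z. \<exists>!rs. z = (fst rs * fst v + snd rs * fst w,
                                     fst rs * snd v + snd rs * snd w))"

definition distant :: "('a::ring_1 \<times> 'a) set \<Rightarrow> ('a \<times> 'a) set \<Rightarrow> bool" where
  "distant p q \<longleftrightarrow> (\<exists>v w. p = pt v \<and> q = pt w \<and> is_basis v w)"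

definition distant_edge :: "('a::ring_1 \<times> 'a) set \<Rightarrow> ('a \<times> 'a) set \<Rightarrow> bool" where
  "distant_edge p q \<longleftrightarrow> p \<in> projline \<and> q \<in> projline \<and> distant p q"

definition Ccomp :: "('a::ring_1 \<times> 'a) set set" where
  "Ccomp = {q. distant_edge\<^sup>*\<^sup>* (pt (1, 0)) q}"

definition projline_sub :: "'a::ring_1 set \<Rightarrow> ('a \<times> 'a) set set" where
  "projline_sub K = {pt (a, b) | a b. a \<in> K \<and> b \<in> K \<and> (a, b) \<noteq> (0, 0)}"

definition K_chains :: "'a::ring_1 set \<Rightarrow> ('a \<times> 'a) set set set" where
  "K_chains K = {(\<lambda>p. act p M) ` projline_sub K | M. M \<in> GL2}"

text \<open>The induced map R(1,0)\<cdot>E(T) \<mapsto> R'(1',0')\<cdot>E(T^\<alpha>) (values as points of P(R')).\<close>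
definition alpha_bar :: "('a::ring_1 \<Rightarrow> 'b::ring_1) \<Rightarrow> ('a \<times> 'a) set \<Rightarrow> ('b \<times> 'b) set" where
  "alpha_bar f p = act (pt (1, 0)) (Eseq (map f (SOME T. p = act (pt (1, 0)) (Eseq T))))"

end

theory Submission
  imports Defs
begin

text \<open>The map is well defined because a Jordan homomorphism respects e(T) x e(rev T) and
  b(T) e(rev T), where (e(T), b(T)) is the first row of E(T): if R(1,0) E(T) = R(1,0), then b(T) = 0
  and e(T), e(rev T) are units, and these two identities carry this over to the image of T.
  A chain in C can be written as P(K) diag(a,d) E(T); its image is governed by the elements
  d^-1 k a = d^-1 (k c) d^-1 with c = a d, which gives sufficiency. For necessity apply the hypothesis to
  P(K) diag(c,1): its image contains R'(1,0) and R'(0,1), so over GL(2,K') the image chain can be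
  normalised to P(K') diag(a',d'), and comparison of the points over k = 1 and general k
  gives u' = d'.\<close>

section \<open>Matrices, units and points\<close>

lemmas mat2_defs = mmul_def vmul_def mid_def

lemma mmul_assoc: "mmul (mmul M N) P = mmul M (mmul N (P :: 'a::ring_1 mat2))"
  by (simp add: mat2_defs algebra_simps)

lemma mmul_mid [simp]: "mmul M mid = M" "mmul mid M = M"
  by (simp_all add: mat2_defs)

lemma vmul_mmul: "vmul v (mmul M N) = vmul (vmul v M) N"
  by (simp add: mat2_defs algebra_simps)

lemma vmul_mid [simp]: "vmul v mid = v"
  by (simp add: mat2_defs)

lemma act_mmul: "act p (mmul M N) = act (act p M) N"
  by (simp add: act_def image_image vmul_mmul)

lemma act_mid [simp]: "act p mid = p"
  by (simp add: act_def)

lemma act_pt: "act (pt v) M = pt (vmul v M)"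
  by (auto simp: act_def pt_def vmul_def image_def algebra_simps)
    (metis (no_types) distrib_left mult.assoc)

lemma GL2I: "mmul M N = mid \<Longrightarrow> mmul N M = mid \<Longrightarrow> M \<in> GL2"
  unfolding GL2_def by blast

lemma GL2_mmul: "M \<in> GL2 \<Longrightarrow> N \<in> GL2 \<Longrightarrow> mmul M N \<in> GL2"
proof -
  assume "M \<in> GL2" "N \<in> GL2"
  then obtain M' N' where "mmul M M' = mid" "mmul M' M = mid" "mmul N N' = mid" "mmul N' N = mid"
    unfolding GL2_def by blast
  then have "mmul (mmul M N) (mmul N' M') = mid" "mmul (mmul N' M') (mmul M N) = mid"
    by (metis mmul_assoc mmul_mid(2))+
  then show ?thesis by (rule GL2I)
qed

lemma ring_unit_mult: "ring_unit a \<Longrightarrow> ring_unit b \<Longrightarrow> ring_unit (a * b)"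
  unfolding ring_unit_def by (metis mult.assoc mult_1)

lemma ring_unit_minus: "ring_unit a \<Longrightarrow> ring_unit (- a)"
  unfolding ring_unit_def by (metis minus_mult_minus)

lemma ring_unitI2: "a * x = 1 \<Longrightarrow> y * a = 1 \<Longrightarrow> ring_unit a"
  unfolding ring_unit_def by (metis mult.assoc mult.right_neutral mult_1)

definition diag2 :: "'a::ring_1 \<Rightarrow> 'a \<Rightarrow> 'a mat2" where
  "diag2 a d = ((a, 0), (0, d))"

lemma diag2_GL2: "ring_unit a \<Longrightarrow> ring_unit d \<Longrightarrow> diag2 a d \<in> GL2"
proof -
  assume "ring_unit a" "ring_unit d"
  then obtain x y where "a * x = 1" "x * a = 1" "d * y = 1" "y * d = 1"
    by (auto simp: ring_unit_def)
  then show ?thesis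
    by (intro GL2I[of _ "diag2 x y"]) (simp_all add: diag2_def mat2_defs)
qed

lemma pt_memb: "v \<in> pt v"
  unfolding pt_def by clarsimp (metis mult_1 prod.collapse)

lemma pt_subsetI: "fst v = r * fst w \<Longrightarrow> snd v = r * snd w \<Longrightarrow> pt v \<subseteq> pt w"
  unfolding pt_def by clarsimp (metis mult.assoc)

lemma pt_unit_left: "ring_unit r \<Longrightarrow> pt (r * a, r * b) = pt (a, b)"
proof -
  assume "ring_unit r"
  then obtain s where "s * r = 1" by (auto simp: ring_unit_def)
  then have "pt (a, b) \<subseteq> pt (r * a, r * b)"
    by (intro pt_subsetI[of _ s]) (simp_all flip: mult.assoc)
  moreover have "pt (r * a, r * b) \<subseteq> pt (a, b)"
    by (intro pt_subsetI[of _ r]) simp_all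
  ultimately show ?thesis by simp
qed

lemma pt_snd_one_inject: "pt (x, 1) = pt (y, 1) \<Longrightarrow> x = y"
  using pt_memb[of "(x, 1)"] by (auto simp: pt_def)

section \<open>Generators of a point and their uniqueness up to units\<close>

definition unimodular :: "'a::ring_1 \<times> 'a \<Rightarrow> bool" where
  "unimodular v \<longleftrightarrow> (\<exists>x y. fst v * x + snd v * y = 1)"

lemma unimodular_vmul: "unimodular v \<Longrightarrow> M \<in> GL2 \<Longrightarrow> unimodular (vmul v M)"
proof -
  assume "unimodular v" "M \<in> GL2"
  then obtain x y N where xy: "fst v * x + snd v * y = 1" and "mmul M N = mid"
    by (auto simp: unimodular_def GL2_def)
  then have "vmul (vmul v M) N = v"
    by (metis vmul_mmul vmul_mid)
  then have "fst (vmul v M) * fst (fst N) + snd (vmul v M) * fst (snd N) = fst v"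
    "fst (vmul v M) * snd (fst N) + snd (vmul v M) * snd (snd N) = snd v"
    by (metis fst_conv vmul_def, metis snd_conv vmul_def)
  then have "fst (vmul v M) * (fst (fst N) * x + snd (fst N) * y)
     + snd (vmul v M) * (fst (snd N) * x + snd (snd N) * y) = 1"
    unfolding xy[symmetric] by (simp add: algebra_simps flip: \<open>_ = fst v\<close> \<open>_ = snd v\<close>)
  then show ?thesis unfolding unimodular_def by blast
qed

text \<open>Each generator is a left multiple of the other, by \<open>r\<close> and by
  \<open>s\<close>. Pairing v = r s v with a column that witnesses unimodularity of \<open>v\<close>
  cancels \<open>v\<close> and leaves r s = 1; the same argument for \<open>w\<close> gives s r =
  1.\<close>

lemma pt_eq_unimodularE:
  assumes "pt v = pt w" "unimodular v" "unimodular w"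
  obtains r where "ring_unit r" "v = (r * fst w, r * snd w)"
proof -
  obtain r where r: "v = (r * fst w, r * snd w)"
    using pt_memb[of v] assms(1) by (auto simp: pt_def)
  obtain s where s: "w = (s * fst v, s * snd v)"
    using pt_memb[of w] assms(1) by (auto simp: pt_def)
  obtain x y where xy: "fst v * x + snd v * y = 1"
    using assms(2) by (auto simp: unimodular_def)
  obtain z t where zt: "fst w * z + snd w * t = 1"
    using assms(3) by (auto simp: unimodular_def)
  have v: "fst v = r * (s * fst v)" "snd v = r * (s * snd v)"
    using r s by (metis fst_conv, metis snd_conv)
  have w: "fst w = s * (r * fst w)" "snd w = s * (r * snd w)"
    using r s by (metis fst_conv, metis snd_conv)
  have "1 = r * (s * fst v) * x + r * (s * snd v) * y"
    using xy v by simp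
  also have "\<dots> = r * s * (fst v * x + snd v * y)"
    by (simp add: algebra_simps)
  finally have rs: "r * s = 1" using xy by simp
  have "1 = s * (r * fst w) * z + s * (r * snd w) * t"
    using zt w by simp
  also have "\<dots> = s * r * (fst w * z + snd w * t)"
    by (simp add: algebra_simps)
  finally have "s * r = 1" using zt by simp
  with rs r show thesis
    by (intro that[of r]) (auto simp: ring_unit_def)
qed

lemma unimodular_unit_vectors [simp]: "unimodular (1, 0)" "unimodular (0, 1)"
  unfolding unimodular_def by (auto intro: exI[of _ 1])

section \<open>Words in the elementary matrices\<close>

lemma Eseq_Nil [simp]: "Eseq [] = mid"
  and Eseq_Cons: "Eseq (t # T) = mmul (Emat t) (Eseq T)"
  by (simp_all add: Eseq_def)

lemma Eseq_append: "Eseq (S @ T) = mmul (Eseq S) (Eseq T)"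
  by (induction S) (simp_all add: Eseq_Cons mmul_assoc)

lemma Eseq_single: "Eseq [t] = Emat t"
  by (simp add: Eseq_Cons)

lemma Eseq_Cons_entries:
  "fst (fst (Eseq (t # T))) = t * fst (fst (Eseq T)) + fst (snd (Eseq T))"
  "fst (snd (Eseq (t # T))) = - fst (fst (Eseq T))"
  "fst (fst (Eseq (rev (t # T)))) = fst (fst (Eseq (rev T))) * t - snd (fst (Eseq (rev T)))"
  "snd (fst (Eseq (rev (t # T)))) = fst (fst (Eseq (rev T)))"
  by (simp_all add: Eseq_Cons Eseq_append Emat_def mat2_defs)

text \<open>A word for the inverse matrix, from E(t)^-1 = E(0) E(-t) E(0). Its letters are only 0
  and negatives of letters of \<open>T\<close>, so forming it commutes with applying a Jordan
  homomorphism letter by letter.\<close>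

definition Einv :: "'a::ring_1 list \<Rightarrow> 'a list" where
  "Einv T = concat (map (\<lambda>t. [0, - t, 0]) (rev T))"

lemma Einv_simps [simp]: "Einv [] = []" "Einv (t # T) = Einv T @ [0, - t, 0]"
  by (simp_all add: Einv_def)

lemma Eseq_Einv_single:
  "mmul (Eseq [0, - t, 0]) (Emat t) = mid" "mmul (Emat t) (Eseq [0, - t, 0]) = mid"
  by (simp_all add: Eseq_Cons Emat_def mat2_defs)

lemma Eseq_Einv [simp]: "mmul (Eseq T) (Eseq (Einv T)) = mid" "mmul (Eseq (Einv T)) (Eseq T) = mid"
proof (induction T)
  case (Cons t T)
  {
    case 1
    have "mmul (Eseq (t # T)) (Eseq (Einv (t # T)))
        = mmul (Emat t) (mmul (mmul (Eseq T) (Eseq (Einv T))) (Eseq [0, - t, 0]))"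
      by (simp add: Eseq_Cons[of t T] Eseq_append mmul_assoc)
    then show ?case using Cons by (simp add: Eseq_Einv_single)
  next
    case 2
    have "mmul (Eseq (Einv (t # T))) (Eseq (t # T))
        = mmul (Eseq (Einv T)) (mmul (mmul (Eseq [0, - t, 0]) (Emat t)) (Eseq T))"
      by (simp add: Eseq_Cons[of t T] Eseq_append mmul_assoc)
    then show ?case using Cons by (simp add: Eseq_Einv_single)
  }
qed simp_all

lemma Eseq_GL2: "Eseq T \<in> GL2"
  unfolding GL2_def using Eseq_Einv by blast

lemma act_Emat: "act (pt (1, 0)) (Emat t) = pt (t, 1)"
  by (simp add: act_pt vmul_def Emat_def)

text \<open>Conjugation by the permutation matrix ((0,1),(1,0)), an automorphism that takes each
  E(t) to its inverse. Hence it takes E(rev T) to the inverse of E(T), which ties the entries of the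
  two words together.\<close>

definition swap2 :: "'a mat2 \<Rightarrow> 'a mat2" where
  "swap2 N = ((snd (snd N), fst (snd N)), (snd (fst N), fst (fst N)))"

lemma swap2_mmul: "swap2 (mmul M N) = mmul (swap2 M) (swap2 N)"
  by (simp add: swap2_def mat2_defs add.commute)

lemma swap2_mid [simp]: "swap2 mid = mid"
  by (simp add: swap2_def mid_def)

lemma swap2_Emat:
  "mmul (Emat t) (swap2 (Emat t)) = mid" "mmul (swap2 (Emat t)) (Emat t) = mid"
  by (simp_all add: swap2_def Emat_def mat2_defs)

lemma Eseq_swap2_rev:
  "mmul (Eseq T) (swap2 (Eseq (rev T))) = mid" "mmul (swap2 (Eseq (rev T))) (Eseq T) = mid"
proof (induction T)
  case (Cons t T)
  have rev: "swap2 (Eseq (rev (t # T))) = mmul (swap2 (Eseq (rev T))) (swap2 (Emat t))"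
    by (simp add: Eseq_append Eseq_single swap2_mmul)
  {
    case 1
    have "mmul (Eseq (t # T)) (swap2 (Eseq (rev (t # T))))
        = mmul (Emat t) (mmul (mmul (Eseq T) (swap2 (Eseq (rev T)))) (swap2 (Emat t)))"
      by (simp only: rev Eseq_Cons[of t T] mmul_assoc)
    then show ?case using Cons by (simp add: swap2_Emat)
  next
    case 2
    have "mmul (swap2 (Eseq (rev (t # T)))) (Eseq (t # T))
        = mmul (swap2 (Eseq (rev T))) (mmul (mmul (swap2 (Emat t)) (Emat t)) (Eseq T))"
      by (simp only: rev Eseq_Cons[of t T] mmul_assoc)
    then show ?case using Cons by (simp add: swap2_Emat)
  }
qed simp_all

section \<open>The connected component\<close>

text \<open>One-sided inverses need not be two-sided in a general ring, so the unit \<open>a\<close>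
  is used first: a n12 = 0 kills the upper right entry of the inverse matrix, and then n22 inverts
  \<open>d\<close> from both sides.\<close>

lemma lower_triangular_GL2:
  assumes "((a, 0), (c, d)) \<in> GL2" "ring_unit a"
  shows "ring_unit d"
proof -
  obtain n11 n12 n21 n22 where
    "mmul ((a, 0), (c, d)) ((n11, n12), (n21, n22)) = mid"
    "mmul ((n11, n12), (n21, n22)) ((a, 0), (c, d)) = mid"
    using assms(1) by (auto simp: GL2_def)
  then have eqs: "a * n12 = 0" "c * n12 + d * n22 = 1" "n22 * d = 1"
    by (simp_all add: mat2_defs)
  obtain x where "x * a = 1" using assms(2) by (auto simp: ring_unit_def)
  then have "n12 = 0" using eqs(1)
    by (metis mult.assoc mult_1 mult_zero_right)
  with eqs show ?thesis by (auto simp: ring_unit_def)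
qed

lemma GL2_fixing_pt_10:
  assumes "M \<in> GL2" "act (pt (1, 0)) M = pt (1, 0)"
  obtains a c d where "M = ((a, 0), (c, d))" "ring_unit a" "ring_unit d"
proof -
  obtain a b c d where M: "M = ((a, b), (c, d))" by (metis prod.collapse)
  have "pt (vmul (1, 0) M) = pt (1, 0)" using assms(2) by (simp add: act_pt)
  then obtain r where "ring_unit r" "vmul (1, 0) M = (r * 1, r * 0)"
    using assms(1) by (elim pt_eq_unimodularE) (auto intro: unimodular_vmul)
  then have "b = 0" "ring_unit a" by (auto simp: M vmul_def)
  with M assms(1) show thesis
    using that lower_triangular_GL2 by blast
qed

text \<open>\<open>M\<close> followed by the inverse of E(T) fixes R(1,0), so it is lower
  triangular, and such a matrix is a diagonal one times a word. This is what puts a chain contained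
  in C into the form P(K) diag(a,d) E(S).\<close>

lemma GL2_eq_diag2_Eseq:
  assumes "M \<in> GL2" "act (pt (1, 0)) M = act (pt (1, 0)) (Eseq T)"
  obtains a d S where "ring_unit a" "ring_unit d" "M = mmul (diag2 a d) (Eseq S)"
proof -
  let ?N = "mmul M (Eseq (Einv T))"
  have "act (pt (1, 0)) ?N = pt (1, 0)"
    using assms(2) by (simp add: act_mmul) (simp flip: act_mmul)
  moreover have "?N \<in> GL2" using assms(1) by (simp add: GL2_mmul Eseq_GL2)
  ultimately obtain a c d where N: "?N = ((a, 0), (c, d))" "ring_unit a" "ring_unit d"
    using GL2_fixing_pt_10 by metis
  obtain e where e: "d * e = 1" "e * d = 1" using N by (auto simp: ring_unit_def)
  \<comment> \<open>E(0) E(-t) is the negative of the matrix ((1,0),(-t,1)); the choice t = d^-1 c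
    clears the entry \<open>c\<close>, and the sign moves into the diagonal.\<close>
  have "mmul ?N (Eseq [0, - (e * c)]) = diag2 (- a) (- d)"
    unfolding N(1) using e by (simp add: Eseq_Cons Emat_def diag2_def mat2_defs flip: mult.assoc)
  then have "mmul (mmul ?N (mmul (Eseq [0, - (e * c)]) (Eseq (Einv [0, - (e * c)])))) (Eseq T)
      = mmul (diag2 (- a) (- d)) (Eseq (Einv [0, - (e * c)] @ T))"
    by (simp only: Eseq_append flip: mmul_assoc)
  then have "M = mmul (diag2 (- a) (- d)) (Eseq (Einv [0, - (e * c)] @ T))"
    by (simp only: Eseq_Einv mmul_mid mmul_assoc)
  moreover have "ring_unit (- a)" "ring_unit (- d)"
    using N(2,3) by (simp_all add: ring_unit_minus)
  ultimately show thesis using that by blast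
qed

section \<open>Distance as invertibility, and the component C as an orbit of words\<close>

lemma is_basis_iff_GL2: "is_basis v w \<longleftrightarrow> (v, w) \<in> GL2"
proof
  assume b: "is_basis v w"
  have eq: "(fst rs * fst v + snd rs * fst w, fst rs * snd v + snd rs * snd w) = vmul rs (v, w)" for rs
    by (simp add: vmul_def)
  have ex: "\<exists>!rs. z = vmul rs (v, w)" for z
    using b unfolding is_basis_def eq by (rule spec)
  obtain r s where rs: "vmul r (v, w) = (1, 0)" "vmul s (v, w) = (0, 1)"
    using ex1_implies_ex[OF ex[of "(1, 0)"]] ex1_implies_ex[OF ex[of "(0, 1)"]]
    by (metis (no_types))
  then have left: "mmul (r, s) (v, w) = mid" by (simp add: mmul_def mid_def)
  have "vmul (vmul x (r, s)) (v, w) = x" for x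
    by (metis left vmul_mmul vmul_mid)
  \<comment> \<open>Both sides are coordinates of the same vector with respect to \<open>v\<close>,
    \<open>w\<close>, so uniqueness of coordinates turns the left inverse into a right
    inverse.\<close>
  then have "vmul (vmul x (v, w)) (r, s) = x" for x
    by (metis (no_types) ex[of "vmul x (v, w)"])
  from this[of "(1, 0)"] this[of "(0, 1)"] have "mmul (v, w) (r, s) = mid"
    by (simp add: mat2_defs)
  then show "(v, w) \<in> GL2" using left by (rule GL2I)
next
  assume "(v, w) \<in> GL2"
  then obtain N where N: "mmul (v, w) N = mid" "mmul N (v, w) = mid"
    by (auto simp: GL2_def)
  have eq: "(fst rs * fst v + snd rs * fst w, fst rs * snd v + snd rs * snd w) = vmul rs (v, w)" for rs
    by (simp add: vmul_def)
  show "is_basis v w"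
    unfolding is_basis_def eq
  proof (intro allI ex1I)
    show "z = vmul (vmul z N) (v, w)" for z
      by (simp add: N flip: vmul_mmul)
    show "rs = vmul z N" if "z = vmul rs (v, w)" for z rs
      using that by (simp add: N flip: vmul_mmul)
  qed
qed

text \<open>The neighbours of R(1,0) are the points R(t,1) = R(1,0) E(t). Transporting by E(T), a
  step along an edge from R(1,0) E(T) prepends one letter to \<open>T\<close>.\<close>

lemma Ccomp_eq: "Ccomp = {act (pt (1, 0)) (Eseq T) | T. True}"
proof (intro equalityI subsetI)
  fix q :: "('a \<times> 'a) set" assume "q \<in> Ccomp"
  then have "distant_edge\<^sup>*\<^sup>* (pt (1, 0)) q" by (simp add: Ccomp_def)
  then have "\<exists>T. q = act (pt (1, 0)) (Eseq T)"
  proof (induction rule: rtranclp_induct)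
    case base
    show ?case by (intro exI[of _ "[]"]) simp
  next
    case (step p q)
    then obtain T v w where T: "p = act (pt (1, 0)) (Eseq T)" and vw: "p = pt v" "q = pt w"
      and G: "(v, w) \<in> GL2"
      unfolding distant_edge_def distant_def is_basis_iff_GL2 by metis
    \<comment> \<open>The inverse of E(T) moves \<open>p\<close> back to R(1,0) and \<open>q\<close>
      to R(c,d) with \<open>d\<close> a unit, that is, to R(d^-1 c, 1).\<close>
    let ?N = "mmul (v, w) (Eseq (Einv T))"
    have "act (pt (1, 0)) ?N = act (pt v) (Eseq (Einv T))"
      by (simp add: act_pt mmul_def vmul_def)
    also have "\<dots> = pt (1, 0)"
      by (simp add: T flip: vw act_mmul)
    finally obtain a c d where N: "?N = ((a, 0), (c, d))" "ring_unit d"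
      using GL2_fixing_pt_10 GL2_mmul[OF G Eseq_GL2] by metis
    obtain e where e: "d * e = 1" "e * d = 1" using N by (auto simp: ring_unit_def)
    have "act q (Eseq (Einv T)) = pt (c, d)"
      using N(1) by (simp add: vw act_pt mmul_def)
    also have "\<dots> = pt (d * (e * c), d * 1)" using e by (simp flip: mult.assoc)
    also have "\<dots> = act (pt (1, 0)) (Emat (e * c))"
      using N(2) by (simp only: pt_unit_left act_Emat)
    finally have "act (act q (Eseq (Einv T))) (Eseq T) = act (pt (1, 0)) (Eseq ((e * c) # T))"
      by (simp add: Eseq_Cons act_mmul)
    then have "q = act (pt (1, 0)) (Eseq ((e * c) # T))"
      by (simp flip: act_mmul)
    then show ?case by blast
  qed
  then show "q \<in> {act (pt (1, 0)) (Eseq T) | T. True}" by blast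
next
  fix q :: "('a \<times> 'a) set" assume "q \<in> {act (pt (1, 0)) (Eseq T) | T. True}"
  then obtain T where q: "q = act (pt (1, 0)) (Eseq T)" by blast
  have proj: "act (pt (1, 0)) (Eseq S) \<in> projline" for S :: "'a list"
    unfolding projline_def act_pt using Eseq_GL2[of S]
    by (auto simp: vmul_def simp del: split_paired_Ex)
  have "distant_edge\<^sup>*\<^sup>* (pt (1, 0)) (act (pt (1, 0)) (Eseq T))"
  proof (induction T)
    case (Cons t T)
    have "((1, 0), (t, 1)) \<in> GL2"
      by (intro GL2I[of _ "((1, 0), (- t, 1))"]) (simp_all add: mat2_defs)
    then have "mmul ((1, 0), (t, 1)) (Eseq T) \<in> GL2"
      by (simp add: GL2_mmul Eseq_GL2)
    then have "(vmul (1, 0) (Eseq T), vmul (t, 1) (Eseq T)) \<in> GL2"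
      by (simp only: mmul_def fst_conv snd_conv)
    moreover have "act (pt (1, 0)) (Eseq (t # T)) = pt (vmul (t, 1) (Eseq T))"
      by (simp only: Eseq_Cons act_mmul act_Emat) (rule act_pt)
    moreover have "act (pt (1, 0)) (Eseq T) = pt (vmul (1, 0) (Eseq T))"
      by (rule act_pt)
    ultimately have "distant (act (pt (1, 0)) (Eseq T)) (act (pt (1, 0)) (Eseq (t # T)))"
      unfolding distant_def is_basis_iff_GL2 by blast
    then show ?case
      by (intro rtranclp.rtrancl_into_rtrancl[OF Cons]) (simp add: distant_edge_def proj)
  qed simp
  then show "q \<in> Ccomp" by (simp add: Ccomp_def q)
qed

section \<open>Jordan homomorphisms\<close>

context
  fixes f :: "'a::ring_1 \<Rightarrow> 'b::ring_1"
  assumes f: "jordan_hom f"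
begin

lemma jordan_add: "f (a + b) = f a + f b"
  and jordan_one: "f 1 = 1"
  and jordan_quad: "f (a * b * a) = f a * f b * f a"
  using f by (auto simp: jordan_hom_def)

lemma jordan_zero: "f 0 = 0"
  using jordan_add[of 0 0] by simp

lemma jordan_minus: "f (- a) = - f a"
  using jordan_add[of a "- a"] by (simp add: jordan_zero eq_neg_iff_add_eq_0 add.commute)

lemma jordan_diff: "f (a - b) = f a - f b"
  using jordan_add[of a "- b"] by (simp add: jordan_minus)

text \<open>Linearization of the quadratic law: replace \<open>a\<close> by \<open>a + c\<close> and
  compare the mixed terms.\<close>

lemma jordan_triple: "f (a * b * c + c * b * a) = f a * f b * f c + f c * f b * f a"
proof -
  have "f ((a + c) * b * (a + c)) = f (a * b * a) + f (c * b * c) + f (a * b * c + c * b * a)"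
    by (simp flip: jordan_add add: algebra_simps)
  then show ?thesis
    unfolding jordan_quad jordan_add[of a c] by (simp add: algebra_simps)
qed

text \<open>Applying \<open>f\<close> to a b^2 a = 1 gives a right inverse of \<open>f a\<close>,
  which can then be cancelled in f a f b f a = f a. The other order follows by exchanging
  \<open>a\<close> and \<open>b\<close>.\<close>

lemma jordan_unit: "a * b = 1 \<Longrightarrow> b * a = 1 \<Longrightarrow> f a * f b = 1"
proof -
  assume ab: "a * b = 1" "b * a = 1"
  have "a * (b * b) * a = 1" using ab by (metis mult.assoc mult_1)
  then have "f a * f (b * b) * f a = 1" by (metis jordan_quad jordan_one)
  then have r: "f a * (f (b * b) * f a) = 1" by (simp add: mult.assoc)
  have "a * b * a = a" using ab by simp
  then have "f a * f b * f a = f a" by (metis jordan_quad)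
  then have "f a * f b * (f a * (f (b * b) * f a)) = f a * (f (b * b) * f a)"
    by (simp flip: mult.assoc)
  then show ?thesis using r by simp
qed

lemma jordan_ring_unit: "ring_unit a \<Longrightarrow> ring_unit (f a)"
  unfolding ring_unit_def using jordan_unit by blast

text \<open>A Jordan homomorphism is only controlled on elements symmetric under reversal of words.
  With (a, c) the first column of E(T) and (p, q) the first row of E(rev T), the expressions below
  are symmetric of this kind, and this family of four is closed under prolonging T.\<close>

lemma jordan_Eseq_invariant:
  fixes T x
  defines "a \<equiv> fst (fst (Eseq T))" and "c \<equiv> fst (snd (Eseq T))"
    and "p \<equiv> fst (fst (Eseq (rev T)))" and "q \<equiv> snd (fst (Eseq (rev T)))"
    and "a' \<equiv> fst (fst (Eseq (map f T)))" and "c' \<equiv> fst (snd (Eseq (map f T)))"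
    and "p' \<equiv> fst (fst (Eseq (rev (map f T))))" and "q' \<equiv> snd (fst (Eseq (rev (map f T))))"
  shows "f (a * x * p) = a' * f x * p' \<and> f (c * x * q) = c' * f x * q' \<and>
    (\<forall>s. f (s * a * x * q - c * x * p * s) = f s * a' * f x * q' - c' * f x * p' * f s) \<and>
    (\<forall>s. f (s * c * x * p - a * x * q * s) = f s * c' * f x * p' - a' * f x * q' * f s)"
  unfolding assms
proof (induction T)
  case Nil
  show ?case by (simp add: mid_def jordan_zero)
next
  case (Cons t T)
  let ?a = "fst (fst (Eseq T))" let ?c = "fst (snd (Eseq T))"
  let ?p = "fst (fst (Eseq (rev T)))" let ?q = "snd (fst (Eseq (rev T)))"
  let ?a' = "fst (fst (Eseq (map f T)))" let ?c' = "fst (snd (Eseq (map f T)))"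
  let ?p' = "fst (fst (Eseq (rev (map f T))))" let ?q' = "snd (fst (Eseq (rev (map f T))))"
  have IH1: "f (?a * x * ?p) = ?a' * f x * ?p'" and IH2: "f (?c * x * ?q) = ?c' * f x * ?q'"
    and IH3: "\<And>s. f (s * ?a * x * ?q - ?c * x * ?p * s) = f s * ?a' * f x * ?q' - ?c' * f x * ?p' * f s"
    and IH4: "\<And>s. f (s * ?c * x * ?p - ?a * x * ?q * s) = f s * ?c' * f x * ?p' - ?a' * f x * ?q' * f s"
    using Cons by blast+
  have 1: "f ((t * ?a + ?c) * x * (?p * t - ?q)) = (f t * ?a' + ?c') * f x * (?p' * f t - ?q')"
  proof -
    \<comment> \<open>The term quadratic in \<open>t\<close> falls under the law for aba, the terms
      linear in \<open>t\<close> form the third expression with s = t, and the last term is the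
      second expression.\<close>
    have "(t * ?a + ?c) * x * (?p * t - ?q)
        = t * (?a * x * ?p) * t - (t * ?a * x * ?q - ?c * x * ?p * t) - ?c * x * ?q"
      by (simp add: algebra_simps)
    then show ?thesis
      by (simp only: jordan_diff jordan_quad IH1 IH2 IH3[unfolded jordan_diff]) (simp add: algebra_simps)
  qed
  have 2: "f (- ?a * x * ?p) = - ?a' * f x * ?p'"
    by (simp add: jordan_minus IH1)
  have 3: "f (s * (t * ?a + ?c) * x * ?p - - ?a * x * (?p * t - ?q) * s)
      = f s * (f t * ?a' + ?c') * f x * ?p' - - ?a' * f x * (?p' * f t - ?q') * f s" for s
  proof -
    \<comment> \<open>The terms containing both \<open>s\<close> and \<open>t\<close> form a
      symmetric triple with a x p in the middle; what remains is the fourth expression.\<close>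
    have "s * (t * ?a + ?c) * x * ?p - - ?a * x * (?p * t - ?q) * s
        = (s * t * (?a * x * ?p) + (?a * x * ?p) * t * s) + (s * ?c * x * ?p - ?a * x * ?q * s)"
      by (simp add: algebra_simps)
    then show ?thesis
      by (simp only: jordan_add[of "_ + _" "_ - _"] jordan_triple IH1 IH4) (simp add: algebra_simps)
  qed
  have 4: "f (s * - ?a * x * (?p * t - ?q) - (t * ?a + ?c) * x * ?p * s)
      = f s * - ?a' * f x * (?p' * f t - ?q') - (f t * ?a' + ?c') * f x * ?p' * f s" for s
  proof -
    have "s * - ?a * x * (?p * t - ?q) - (t * ?a + ?c) * x * ?p * s
        = (s * ?a * x * ?q - ?c * x * ?p * s) - (s * (?a * x * ?p) * t + t * (?a * x * ?p) * s)"
      by (simp add: algebra_simps)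
    then show ?thesis
      by (simp only: jordan_diff[of "_ - _" "_ + _"] jordan_triple IH1 IH3) (simp add: algebra_simps)
  qed
  show ?case
    unfolding list.map Eseq_Cons_entries using 1 2 3 4 by blast
qed

lemma jordan_Eseq_quad:
  "f (fst (fst (Eseq T)) * x * fst (fst (Eseq (rev T))))
    = fst (fst (Eseq (map f T))) * f x * fst (fst (Eseq (rev (map f T))))"
  using jordan_Eseq_invariant[where T = T and x = x] by blast

text \<open>Appending a letter \<open>t\<close> makes the two products trade places up to the term a
  t p, which \<open>jordan_Eseq_quad\<close> controls at x = t. Hence both are proved together, by
  induction from the right end of the word.\<close>

lemma jordan_Eseq_mixed:
  "f (snd (fst (Eseq T)) * fst (fst (Eseq (rev T))))
      = snd (fst (Eseq (map f T))) * fst (fst (Eseq (rev (map f T)))) \<and>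
    f (fst (fst (Eseq T)) * fst (snd (Eseq (rev T))))
      = fst (fst (Eseq (map f T))) * fst (snd (Eseq (rev (map f T))))"
proof (induction T rule: rev_induct)
  case Nil
  show ?case by (simp add: mid_def jordan_zero)
next
  case (snoc t T)
  let ?a = "fst (fst (Eseq T))" let ?b = "snd (fst (Eseq T))"
  let ?p = "fst (fst (Eseq (rev T)))" let ?r = "fst (snd (Eseq (rev T)))"
  have "f (?a * (t * ?p + ?r)) = f (?a * t * ?p) + f (?a * ?r)"
    by (simp add: algebra_simps flip: jordan_add)
  moreover have "f ((?a * t - ?b) * - ?p) = f (?b * ?p) - f (?a * t * ?p)"
    by (simp add: algebra_simps flip: jordan_diff)
  ultimately show ?case
    using snoc
    by (simp add: Eseq_Cons Eseq_append Emat_def mat2_defs jordan_Eseq_quad) (simp add: algebra_simps)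
qed

section \<open>Well-definedness of the induced map\<close>

lemma Eseq_fixes_pt_10_jordan:
  assumes "act (pt (1, 0)) (Eseq T) = pt (1, 0)"
  shows "act (pt (1, 0)) (Eseq (map f T)) = pt (1, 0)"
proof -
  obtain a c d where M: "Eseq T = ((a, 0), (c, d))" "ring_unit a" "ring_unit d"
    using GL2_fixing_pt_10[OF Eseq_GL2 assms] by metis
  obtain p q r w where N: "Eseq (rev T) = ((p, q), (r, w))" by (metis prod.collapse)
  obtain a' b' c' d' where M': "Eseq (map f T) = ((a', b'), (c', d'))" by (metis prod.collapse)
  obtain p' q' r' w' where N': "Eseq (rev (map f T)) = ((p', q'), (r', w'))" by (metis prod.collapse)
  \<comment> \<open>Entries of E(T) times its inverse \<open>swap2 (Eseq (rev T))\<close>, in both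
    orders; they will show that \<open>p\<close> is the inverse of \<open>d\<close>.\<close>
  have "a * r = 0" "c * r + d * p = 1" "p * d = 1"
    using Eseq_swap2_rev[of T] by (auto simp: M N swap2_def mat2_defs)
  moreover obtain i where i: "a * i = 1" "i * a = 1"
    using M by (auto simp: ring_unit_def)
  ultimately have "r = 0" by (metis mult.assoc mult_1 mult_zero_right)
  then have d: "d * p = 1" "p * d = 1" using \<open>c * r + d * p = 1\<close> \<open>p * d = 1\<close> by auto
  \<comment> \<open>The middle factors are chosen so that both products are 1. Applying
    \<open>f\<close> to them gives one-sided inverses of a' and p' on both sides.\<close>
  have "a * (i * d) * p = 1" "p * (d * i) * a = 1"
    using i d by (metis mult.assoc mult_1)+
  moreover have "f (a * (i * d) * p) = a' * f (i * d) * p'"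
    using jordan_Eseq_quad[of T "i * d"] by (simp add: M N M' N')
  moreover have "f (p * (d * i) * a) = p' * f (d * i) * a'"
    using jordan_Eseq_quad[of "rev T" "d * i"] by (simp add: M N M' N' rev_map[symmetric])
  ultimately have *: "a' * (f (i * d) * p') = 1" "p' * (f (d * i) * a') = 1"
     "(a' * f (i * d)) * p' = 1" "(p' * f (d * i)) * a' = 1"
    by (simp_all add: jordan_one mult.assoc)
  have "b' * p' = 0"
    using jordan_Eseq_mixed[of T] by (simp add: M N M' N' jordan_zero)
  \<comment> \<open>p' has a right inverse, so it can be cancelled.\<close>
  then have "b' = 0"
    using *(2) by (metis mult.assoc mult.right_neutral mult_zero_left)
  moreover have "ring_unit a'" using *(1,4) by (rule ring_unitI2)
  ultimately show ?thesis
    using pt_unit_left[of a' 1 0] by (simp add: act_pt vmul_def M')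
qed

lemma map_Einv: "map f (Einv T) = Einv (map f T)"
  by (induction T) (simp_all add: jordan_zero jordan_minus)

text \<open>The word picked by \<open>SOME\<close> may differ from \<open>T\<close>, but followed by
  \<open>Einv T\<close> it fixes R(1,0), and so does its image under \<open>f\<close>. Multiplying
  by E(map f T) then identifies the two values.\<close>

lemma alpha_bar_Eseq:
  "alpha_bar f (act (pt (1, 0)) (Eseq T)) = act (pt (1, 0)) (Eseq (map f T))"
proof -
  define S where "S = (SOME S. act (pt (1, 0)) (Eseq T) = act (pt (1, 0)) (Eseq S))"
  have "act (pt (1, 0)) (Eseq T) = act (pt (1, 0)) (Eseq S)"
    unfolding S_def by (rule someI) (rule refl)
  then have "act (pt (1, 0)) (Eseq (S @ Einv T)) = pt (1, 0)"
    by (metis Eseq_append act_mmul act_mid Eseq_Einv(1))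
  then have "act (pt (1, 0)) (Eseq (map f S @ Einv (map f T))) = pt (1, 0)"
    using Eseq_fixes_pt_10_jordan[of "S @ Einv T"] by (simp add: map_Einv)
  then have "act (act (pt (1, 0)) (Eseq (map f S @ Einv (map f T)))) (Eseq (map f T))
      = act (pt (1, 0)) (Eseq (map f T))"
    by simp
  then have "act (pt (1, 0)) (Eseq (map f S)) = act (pt (1, 0)) (Eseq (map f T))"
    by (simp add: Eseq_append mmul_assoc flip: act_mmul)
  then show ?thesis by (simp add: alpha_bar_def S_def)
qed

end

section \<open>Chains\<close>

lemma subfieldD:
  assumes "subfield K"
  shows "0 \<in> K" "1 \<in> K" "x \<in> K \<Longrightarrow> y \<in> K \<Longrightarrow> x + y \<in> K"
    "x \<in> K \<Longrightarrow> y \<in> K \<Longrightarrow> x * y \<in> K" "x \<in> K \<Longrightarrow> - x \<in> K"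
    "x \<in> K \<Longrightarrow> y \<in> K \<Longrightarrow> x - y \<in> K"
proof -
  show "x \<in> K \<Longrightarrow> y \<in> K \<Longrightarrow> x - y \<in> K"
    using assms unfolding subfield_def by (metis diff_conv_add_uminus)
qed (use assms in \<open>auto simp: subfield_def\<close>)

lemma subfield_inverseE:
  assumes "subfield K" "x \<in> K" "x \<noteq> 0"
  obtains y where "y \<in> K" "x * y = 1" "y * x = 1"
  using assms unfolding subfield_def by blast

lemma subfield_ring_unit: "subfield K \<Longrightarrow> x \<in> K \<Longrightarrow> x \<noteq> 0 \<Longrightarrow> ring_unit x"
  by (metis ring_unit_def subfield_inverseE)

lemma pt_projline_sub: "a \<in> K \<Longrightarrow> b \<in> K \<Longrightarrow> (a, b) \<noteq> (0, 0) \<Longrightarrow> pt (a, b) \<in> projline_sub K"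
  unfolding projline_sub_def by blast

lemma image_act_K_chains: "M \<in> GL2 \<Longrightarrow> (\<lambda>p. act p M) ` projline_sub K \<in> K_chains K"
  unfolding K_chains_def by blast

lemma subfield_unimodular:
  assumes "subfield K" "k \<in> K" "l \<in> K" "(k, l) \<noteq> (0, 0)"
  shows "unimodular (k, l)"
proof (cases "k = 0")
  case True
  then obtain y where "l * y = 1" using assms by (auto elim: subfield_inverseE[of K l])
  with True show ?thesis by (auto simp: unimodular_def)
next
  case False
  then obtain y where "k * y = 1" using assms by (auto elim: subfield_inverseE[of K k])
  then have "fst (k, l) * y + snd (k, l) * 0 = 1" by simp
  then show ?thesis unfolding unimodular_def by blast
qed

text \<open>R(ka, ld) is R(1,0) for l = 0; otherwise dividing by the unit ld on the left leaves m =
  l^-1 k between d^-1 and \<open>a\<close>.\<close>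

lemma act_diag2_cases:
  assumes K: "subfield K" "k \<in> K" "l \<in> K" "(k, l) \<noteq> (0, 0)"
    and units: "ring_unit a" "e * d = 1" "d * e = 1"
  obtains "act (pt (k, l)) (diag2 a d) = pt (1, 0)"
  | m where "m \<in> K" "act (pt (k, l)) (diag2 a d) = pt (e * m * a, 1)"
proof (cases "l = 0")
  case True
  then have "ring_unit (k * a)"
    using K units by (auto intro: ring_unit_mult subfield_ring_unit)
  then have "act (pt (k, l)) (diag2 a d) = pt (1, 0)"
    using pt_unit_left[of "k * a" 1 0] True by (simp add: act_pt vmul_def diag2_def)
  then show thesis by (rule that)
next
  case False
  then obtain j where j: "j \<in> K" "l * j = 1" "j * l = 1"
    using K by (auto elim: subfield_inverseE[of K l])
  have "ring_unit (l * d)"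
    using K units False subfield_ring_unit[of K l] by (auto intro!: ring_unit_mult simp: ring_unit_def[of d])
  then have "pt ((l * d) * (e * (j * k) * a), (l * d) * 1) = pt (e * (j * k) * a, 1)"
    by (rule pt_unit_left)
  moreover have "(l * d) * (e * (j * k) * a) = k * a"
  proof -
    have "(l * d) * (e * (j * k) * a) = l * (d * e) * j * k * a" by (simp add: mult.assoc)
    then show ?thesis using units j by simp
  qed
  ultimately have "act (pt (k, l)) (diag2 a d) = pt (e * (j * k) * a, 1)"
    by (simp add: act_pt vmul_def diag2_def)
  moreover have "j * k \<in> K" using j K subfieldD by blast
  ultimately show thesis using that by blast
qed

text \<open>Invertibility over the whole ring only yields a trivial kernel; elimination with pivots
  in \<open>K\<close> then keeps the solution inside \<open>K\<close>. The inverse matrix itself is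
  not examined for entries in \<open>K\<close>.\<close>

lemma subfield_GL2_solve:
  assumes K: "subfield K" and in_K: "a \<in> K" "b \<in> K" "c \<in> K" "d \<in> K" "x \<in> K" "y \<in> K"
    and G: "((a, b), (c, d)) \<in> GL2"
  obtains m n where "m \<in> K" "n \<in> K" "vmul (m, n) ((a, b), (c, d)) = (x, y)"
proof -
  note closed = subfieldD[OF K]
  obtain N where N: "mmul ((a, b), (c, d)) N = mid"
    using G by (auto simp: GL2_def)
  have kernel: "v = (0, 0)" if "vmul v ((a, b), (c, d)) = (0, 0)" for v
  proof -
    have "vmul (vmul v ((a, b), (c, d))) N = v" by (simp add: N flip: vmul_mmul)
    then show ?thesis using that by (simp add: vmul_def)
  qed
  show thesis
  proof (cases "a = 0")
    case False
    then obtain i where i: "i \<in> K" "a * i = 1" "i * a = 1"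
      using K in_K by (auto elim: subfield_inverseE[of K a])
    \<comment> \<open>The Schur complement of the pivot \<open>a\<close>; if it vanished, the row
      (-c a^-1, 1) would lie in the kernel.\<close>
    define e where "e = d - c * i * b"
    have "e \<noteq> 0"
    proof
      assume "e = 0"
      then have "vmul (- (c * i), 1) ((a, b), (c, d)) = (0, 0)"
        using i by (simp add: vmul_def e_def mult.assoc)
      then show False using kernel by fastforce
    qed
    moreover have "e \<in> K" unfolding e_def using i in_K closed by auto
    ultimately obtain j where j: "j \<in> K" "j * e = 1"
      using K by (auto elim: subfield_inverseE[of K e])
    define n where "n = (y - x * i * b) * j"
    define m where "m = (x - n * c) * i"
    have "n \<in> K" "m \<in> K" unfolding n_def m_def using i j in_K closed by auto
    moreover have "m * a + n * c = x"
      using i by (simp add: m_def mult.assoc)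
    moreover have "m * b + n * d = y"
    proof -
      have "m * b + n * d = x * i * b + n * e"
        by (simp add: m_def e_def algebra_simps)
      also have "n * e = y - x * i * b" using j by (simp add: n_def mult.assoc)
      finally show ?thesis by simp
    qed
    ultimately show thesis using that by (simp add: vmul_def)
  next
    case True
    have "b \<noteq> 0" using kernel[of "(1, 0)"] True by (auto simp: vmul_def)
    then obtain i where i: "i \<in> K" "i * b = 1"
      using K in_K by (auto elim: subfield_inverseE[of K b])
    have "c \<noteq> 0"
    proof
      assume "c = 0"
      then have "vmul (- (d * i), 1) ((a, b), (c, d)) = (0, 0)"
        using i True by (simp add: vmul_def mult.assoc)
      then show False using kernel by fastforce
    qed
    then obtain j where j: "j \<in> K" "j * c = 1"
      using K in_K by (auto elim: subfield_inverseE[of K c])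
    define n where "n = x * j"
    define m where "m = (y - n * d) * i"
    have "n \<in> K" "m \<in> K" unfolding n_def m_def using i j in_K closed by auto
    moreover have "vmul (m, n) ((a, b), (c, d)) = (x, y)"
      using True i j by (simp add: vmul_def n_def m_def mult.assoc)
    ultimately show thesis using that by blast
  qed
qed

text \<open>The rows over \<open>K\<close> that \<open>M\<close> sends to (a,0) and (0,d) form a
  matrix G with G M = diag(a,d). Since G is invertible, each row over \<open>K\<close> is (g,h) G
  with g, h in \<open>K\<close>, and so its image under \<open>M\<close> is (g,h) diag(a,d).\<close>

lemma chain_through_base_points:
  assumes K: "subfield K" and M: "M \<in> GL2"
    and pts: "pt (1, 0) \<in> (\<lambda>p. act p M) ` projline_sub K" "pt (0, 1) \<in> (\<lambda>p. act p M) ` projline_sub K"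
  obtains a d where "ring_unit a" "ring_unit d"
    "(\<lambda>p. act p M) ` projline_sub K \<subseteq> (\<lambda>p. act p (diag2 a d)) ` projline_sub K"
proof -
  obtain k l where kl: "k \<in> K" "l \<in> K" "(k, l) \<noteq> (0, 0)" "pt (vmul (k, l) M) = pt (1, 0)"
    using pts(1) by (auto simp: projline_sub_def act_pt)
  obtain m n where mn: "m \<in> K" "n \<in> K" "(m, n) \<noteq> (0, 0)" "pt (vmul (m, n) M) = pt (0, 1)"
    using pts(2) by (auto simp: projline_sub_def act_pt)
  obtain a where a: "ring_unit a" "vmul (k, l) M = (a, 0)"
    using kl K M by (auto elim!: pt_eq_unimodularE intro: unimodular_vmul subfield_unimodular)
  obtain d where d: "ring_unit d" "vmul (m, n) M = (0, d)"
    using mn K M by (auto elim!: pt_eq_unimodularE intro: unimodular_vmul subfield_unimodular)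
  let ?G = "((k, l), (m, n))"
  have GM: "mmul ?G M = diag2 a d" using a d by (simp add: mmul_def diag2_def)
  obtain N where N: "mmul M N = mid" "mmul N M = mid" using M by (auto simp: GL2_def)
  then have "N \<in> GL2" by (metis GL2I)
  moreover have "?G = mmul (diag2 a d) N"
    using N by (simp add: GM[symmetric] mmul_assoc)
  ultimately have G: "?G \<in> GL2" using a d by (simp add: GL2_mmul diag2_GL2)
  have "act p M \<in> (\<lambda>p. act p (diag2 a d)) ` projline_sub K" if "p \<in> projline_sub K" for p
  proof -
    obtain x y where p: "p = pt (x, y)" "x \<in> K" "y \<in> K" "(x, y) \<noteq> (0, 0)"
      using \<open>p \<in> _\<close> by (auto simp: projline_sub_def)
    obtain g h where gh: "g \<in> K" "h \<in> K" "vmul (g, h) ?G = (x, y)"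
      using subfield_GL2_solve[OF K kl(1,2) mn(1,2) p(2,3) G] by blast
    then have "(g, h) \<noteq> (0, 0)" using p by (auto simp: vmul_def)
    with gh have "pt (g, h) \<in> projline_sub K" by (auto intro: pt_projline_sub)
    moreover have "act p M = act (pt (g, h)) (diag2 a d)"
      by (simp add: p act_pt flip: GM gh(3) vmul_mmul)
    ultimately show ?thesis by blast
  qed
  with a d show thesis using that by blast
qed

section \<open>The two directions of the equivalence\<close>

lemma alpha_bar_base_points:
  assumes "jordan_hom f"
  shows "alpha_bar f (pt (1, 0)) = pt (1, 0)" "alpha_bar f (pt (t, 1)) = pt (f t, 1)"
  using alpha_bar_Eseq[OF assms, of "[]"] alpha_bar_Eseq[OF assms, of "[t]"]
  by (simp_all add: Eseq_single act_Emat)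

lemma base_points_Ccomp: "pt (1, 0) \<in> Ccomp" "pt (t, 1) \<in> Ccomp"
proof -
  show "pt (1, 0) \<in> Ccomp"
    unfolding Ccomp_eq by (auto intro!: exI[of _ "[]"])
  show "pt (t, 1) \<in> Ccomp"
    unfolding Ccomp_eq by (auto intro!: exI[of _ "[t]"] simp: Eseq_single act_Emat)
qed

lemma chain_condition_necessary:
  fixes f :: "'a::ring_1 \<Rightarrow> 'b::ring_1"
  assumes K: "subfield K" and K': "subfield K'" and f: "jordan_hom f"
    and chains: "\<And>D. D \<in> K_chains K \<Longrightarrow> D \<subseteq> Ccomp \<Longrightarrow> \<exists>D' \<in> K_chains K'. alpha_bar f ` D \<subseteq> D'"
    and c: "ring_unit c"
  shows "\<exists>u v. ring_unit u \<and> u * v = 1 \<and> v * u = 1 \<and>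
    f ` {k * c | k. k \<in> K} \<subseteq> {v * k' * u * f c | k'. k' \<in> K'}"
proof -
  let ?D = "(\<lambda>p. act p (diag2 c 1)) ` projline_sub K"
  have unit1: "ring_unit (1::'a)" by (auto simp: ring_unit_def)
  have "?D \<in> K_chains K" by (intro image_act_K_chains diag2_GL2 c unit1)
  moreover have "?D \<subseteq> Ccomp"
  proof safe
    fix p assume "p \<in> projline_sub K"
    then obtain k l where kl: "p = pt (k, l)" "k \<in> K" "l \<in> K" "(k, l) \<noteq> (0, 0)"
      by (auto simp: projline_sub_def)
    show "act p (diag2 c 1) \<in> Ccomp"
      unfolding kl(1)
      \<comment> \<open>With d = e = 1 every point of the chain is R(1,0) or some R(mc, 1).\<close>
      by (rule act_diag2_cases[OF K kl(2-4) c, of 1 1]) (simp_all add: base_points_Ccomp)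
  qed
  ultimately obtain D' where D': "D' \<in> K_chains K'" "alpha_bar f ` ?D \<subseteq> D'"
    using chains by meson
  then obtain M' where M': "M' \<in> GL2"
    "alpha_bar f ` ?D \<subseteq> (\<lambda>p. act p M') ` projline_sub K'"
    unfolding K_chains_def by blast
  have kc: "pt (f (k * c), 1) \<in> alpha_bar f ` ?D" if "k \<in> K" for k
  proof -
    have "pt (k, 1) \<in> projline_sub K"
      using that subfieldD[OF K] by (auto intro: pt_projline_sub)
    then have "alpha_bar f (act (pt (k, 1)) (diag2 c 1)) \<in> alpha_bar f ` ?D" by (intro imageI)
    then show ?thesis
      by (simp add: act_pt vmul_def diag2_def alpha_bar_base_points[OF f])
  qed
  have "pt (1, 0) \<in> alpha_bar f ` ?D"
  proof -
    have "pt (1, 0) \<in> projline_sub K"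
      using subfieldD[OF K] by (auto intro: pt_projline_sub)
    then have "act (pt (1, 0)) (diag2 c 1) \<in> ?D" by (rule imageI)
    moreover have "act (pt (1, 0)) (diag2 c 1) = pt (1, 0)"
      using pt_unit_left[OF c, of 1 0] by (simp add: act_pt vmul_def diag2_def)
    ultimately show ?thesis
      using alpha_bar_base_points(1)[OF f] by (metis imageI)
  qed
  moreover have "pt (0, 1) \<in> alpha_bar f ` ?D"
    using kc[of 0] subfieldD[OF K] by (simp add: jordan_zero[OF f])
  ultimately obtain a d where ad: "ring_unit a" "ring_unit d"
    and sub: "(\<lambda>p. act p M') ` projline_sub K' \<subseteq> (\<lambda>p. act p (diag2 a d)) ` projline_sub K'"
    using chain_through_base_points[OF K' M'(1) subsetD[OF M'(2)] subsetD[OF M'(2)]] by metis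
  obtain e where e: "d * e = 1" "e * d = 1" using ad by (auto simp: ring_unit_def)
  have form: "\<exists>m \<in> K'. f (k * c) = e * m * a" if "k \<in> K" for k
  proof -
    obtain x y where xy: "x \<in> K'" "y \<in> K'" "(x, y) \<noteq> (0, 0)"
      and eq: "pt (f (k * c), 1) = act (pt (x, y)) (diag2 a d)"
      using subsetD[OF sub subsetD[OF M'(2) kc[OF \<open>k \<in> K\<close>]]] unfolding projline_sub_def by blast
    show ?thesis
    proof (rule act_diag2_cases[OF K' xy ad(1) e(2,1)])
      \<comment> \<open>Impossible, since every vector in R'(1,0) has second coordinate 0.\<close>
      assume "act (pt (x, y)) (diag2 a d) = pt (1, 0)"
      then have "(f (k * c), 1) \<in> pt (1, 0)" using eq pt_memb by metis
      then show ?thesis by (simp add: pt_def)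
    next
      fix m assume "m \<in> K'" "act (pt (x, y)) (diag2 a d) = pt (e * m * a, 1)"
      then show ?thesis using eq pt_snd_one_inject by metis
    qed
  qed
  obtain k0 where k0: "k0 \<in> K'" "f c = e * k0 * a"
    using form[of 1] subfieldD[OF K] by auto
  have "f c \<noteq> 0" using jordan_ring_unit[OF f c] by (auto simp: ring_unit_def)
  then have "k0 \<noteq> 0" using k0 by auto
  then obtain j where j: "j \<in> K'" "j * k0 = 1"
    using k0 K' by (auto elim: subfield_inverseE[of K' k0])
  have "f (k * c) \<in> {e * k' * d * f c | k'. k' \<in> K'}" if k: "k \<in> K" for k
  proof -
    obtain m where m: "m \<in> K'" "f (k * c) = e * m * a" using form[OF k] by blast
    \<comment> \<open>The case k = 1 gives a = k0^-1 d f(c). Substituting this in f(kc) = d^-1 m a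
      shows that \<open>d\<close> serves as the conjugating unit.\<close>
    have "e * (m * j) * d * f c = e * m * j * (d * e) * k0 * a"
      by (simp add: k0 mult.assoc)
    also have "\<dots> = e * m * (j * k0) * a" using e by (simp add: mult.assoc)
    also have "\<dots> = f (k * c)" using m j by simp
    finally have "f (k * c) = e * (m * j) * d * f c" by simp
    moreover have "m * j \<in> K'" using m j subfieldD[OF K'] by blast
    ultimately show ?thesis by blast
  qed
  then show ?thesis using e ad by (intro exI[of _ d] exI[of _ e]) auto
qed

lemma chain_condition_sufficient:
  fixes f :: "'a::ring_1 \<Rightarrow> 'b::ring_1"
  assumes K: "subfield K" and K': "subfield K'" and f: "jordan_hom f"
    and cond: "\<And>c. ring_unit c \<Longrightarrow> \<exists>u v. ring_unit u \<and> u * v = 1 \<and> v * u = 1 \<and>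
      f ` {k * c | k. k \<in> K} \<subseteq> {v * k' * u * f c | k'. k' \<in> K'}"
    and D: "D \<in> K_chains K" "D \<subseteq> Ccomp"
  shows "\<exists>D' \<in> K_chains K'. alpha_bar f ` D \<subseteq> D'"
proof -
  obtain M where M: "M \<in> GL2" "D = (\<lambda>p. act p M) ` projline_sub K"
    using D(1) by (auto simp: K_chains_def)
  have "pt (1, 0) \<in> projline_sub K"
    using subfieldD[OF K] by (auto intro: pt_projline_sub)
  then have "act (pt (1, 0)) M \<in> Ccomp" using D(2) M(2) by blast
  then obtain T0 where "act (pt (1, 0)) M = act (pt (1, 0)) (Eseq T0)"
    unfolding Ccomp_eq by blast
  then obtain a d T where ad: "ring_unit a" "ring_unit d" and MT: "M = mmul (diag2 a d) (Eseq T)"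
    using GL2_eq_diag2_Eseq[OF M(1)] by metis
  obtain e where e: "d * e = 1" "e * d = 1" using ad by (auto simp: ring_unit_def)
  have fe: "f d * f e = 1" "f e * f d = 1" using e by (auto intro: jordan_unit[OF f])
  have ad_unit: "ring_unit (a * d)" using ad by (rule ring_unit_mult)
  then obtain u v where uv: "ring_unit u" "u * v = 1" "v * u = 1"
    and sub: "f ` {k * (a * d) | k. k \<in> K} \<subseteq> {v * k' * u * f (a * d) | k'. k' \<in> K'}"
    using cond by blast
  \<comment> \<open>Chosen so that multiplying (f(d^-1 m a), 1) on the left by the unit u f(d) gives
    (k' b, u f(d)), a point of P(K') diag(b, u f(d)).\<close>
  define b where "b = u * f (a * d) * f e"
  have unit_b: "ring_unit b" "ring_unit (u * f d)"
    unfolding b_def using uv ad_unit ad fe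
    by (auto intro!: ring_unit_mult jordan_ring_unit[OF f] simp: ring_unit_def[of e])
      (use e in \<open>auto simp: ring_unit_def\<close>)
  let ?P = "projline_sub K'" and ?G = "diag2 b (u * f d)"
  have "mmul ?G (Eseq (map f T)) \<in> GL2"
    by (intro GL2_mmul diag2_GL2 unit_b Eseq_GL2)
  then have chain: "(\<lambda>p. act p (mmul ?G (Eseq (map f T)))) ` ?P \<in> K_chains K'"
    by (rule image_act_K_chains)
  have G10: "\<exists>p \<in> ?P. pt (1, 0) = act p ?G"
  proof
    show "pt (1, 0) = act (pt (1, 0)) ?G"
      using pt_unit_left[OF unit_b(1), of 1 0] by (simp add: act_pt vmul_def diag2_def)
    show "pt (1, 0) \<in> ?P" using subfieldD[OF K'] by (auto intro: pt_projline_sub)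
  qed
  have Gm: "\<exists>p \<in> ?P. pt (f (e * m * a), 1) = act p ?G" if m: "m \<in> K" for m
  proof -
    obtain k' where k': "k' \<in> K'" "f (m * (a * d)) = v * k' * u * f (a * d)"
      using sub m by blast
    \<comment> \<open>\<open>f\<close> need not respect the product e m a, but this rewriting has
      the shape xyx, with an element of K(ad) in the middle where the hypothesis on c = ad
      applies.\<close>
    have "e * m * a = e * (m * (a * d)) * e" using e by (simp add: mult.assoc)
    then have "f (e * m * a) = f e * (v * k' * u * f (a * d)) * f e"
      by (simp only: jordan_quad[OF f] k')
    then have "(u * f d) * f (e * m * a) = u * (f d * f e) * v * k' * u * f (a * d) * f e"
      by (simp add: mult.assoc)
    also have "\<dots> = k' * b"
      using fe uv by (simp add: b_def mult.assoc)
    finally have "pt (k' * b, u * f d) = pt ((u * f d) * f (e * m * a), (u * f d) * 1)" by simp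
    also have "\<dots> = pt (f (e * m * a), 1)" by (rule pt_unit_left[OF unit_b(2)])
    finally have "pt (f (e * m * a), 1) = act (pt (k', 1)) ?G"
      by (simp add: act_pt vmul_def diag2_def)
    moreover have "pt (k', 1) \<in> ?P"
      using k' subfieldD[OF K'] by (auto intro: pt_projline_sub)
    ultimately show ?thesis by blast
  qed
  have "alpha_bar f (act p M) \<in> (\<lambda>p. act p (mmul ?G (Eseq (map f T)))) ` ?P"
    if "p \<in> projline_sub K" for p
  proof -
    obtain k l where kl: "p = pt (k, l)" "k \<in> K" "l \<in> K" "(k, l) \<noteq> (0, 0)"
      using \<open>p \<in> _\<close> by (auto simp: projline_sub_def)
    have "\<exists>p' \<in> ?P. alpha_bar f (act p M) = act (act p' ?G) (Eseq (map f T))"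
    proof (rule act_diag2_cases[OF K kl(2-4) ad(1) e(2,1)])
      assume "act (pt (k, l)) (diag2 a d) = pt (1, 0)"
      then have "alpha_bar f (act p M) = act (pt (1, 0)) (Eseq (map f T))"
        by (simp add: kl MT act_mmul alpha_bar_Eseq[OF f])
      then show ?thesis using G10 by metis
    next
      fix m assume m: "m \<in> K" "act (pt (k, l)) (diag2 a d) = pt (e * m * a, 1)"
      \<comment> \<open>The point R(t,1) E(T) is the value at R(1,0) of the word \<open>T\<close>
        with \<open>t\<close> prepended, so \<open>alpha_bar\<close> can be evaluated on it.\<close>
      then have "act p M = act (pt (1, 0)) (Eseq ((e * m * a) # T))"
        by (simp add: kl MT Eseq_Cons act_mmul act_Emat)
      then have "alpha_bar f (act p M) = act (pt (1, 0)) (Eseq (map f ((e * m * a) # T)))"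
        by (simp only: alpha_bar_Eseq[OF f])
      then have "alpha_bar f (act p M) = act (pt (f (e * m * a), 1)) (Eseq (map f T))"
        by (simp add: Eseq_Cons act_mmul act_Emat)
      then show ?thesis using Gm[OF m(1)] by metis
    qed
    then show ?thesis by (auto simp: act_mmul)
  qed
  then show ?thesis using chain M(2) by blast
qed

theorem theorem5p2:
  fixes K :: "'a::ring_1 set" and K' :: "'b::ring_1 set" and \<alpha> :: "'a \<Rightarrow> 'b"
  assumes "subfield K" and "subfield K'" and "jordan_hom \<alpha>"
  shows "(\<forall>D \<in> K_chains K. D \<subseteq> Ccomp \<longrightarrow>
            (\<exists>D' \<in> K_chains K'. alpha_bar \<alpha> ` D \<subseteq> D')) \<longleftrightarrow>
         (\<forall>c. ring_unit c \<longrightarrow>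
            (\<exists>u v. ring_unit u \<and> u * v = 1 \<and> v * u = 1 \<and>
               \<alpha> ` {k * c | k. k \<in> K} \<subseteq> {v * k' * u * \<alpha> c | k'. k' \<in> K'}))"
  (is "?chains \<longleftrightarrow> ?cond")
proof
  assume ?chains
  then show ?cond
    by (intro allI impI chain_condition_necessary[OF assms]) simp_all
next
  assume ?cond
  then show ?chains
    by (intro ballI impI chain_condition_sufficient[OF assms]) simp_all
qed

end
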